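(* Let $\phi:\mathbb R^n\to\mathbb R^C$ be the server output map, $\mathcal L_\phi:\mathbb R^C\to\mathbb R$ the loss as a function of the server output, and $\mathcal L(s)=\mathcal L_\phi(\phi(s))$. Assume that for a constant $M$ one has $\nabla^2\mathcal L_\phi(u)\preceq M I$ for every $u\in\mathbb R^C$. Fix $s_0\in\mathbb R^n$, let $J_s$ be the Jacobian of $\phi$ at $s_0$, $P=J_s^{\top}J_s$, $g_0=\nabla\mathcal L(s_0)$, and for $\delta\in\mathbb R^n$ define $$\widehat F_{\mathrm J}(\delta):=\mathcal L(s_0)+\langle g_0,\delta\rangle+\tfrac M2\,\delta^{\top}P\delta .$$ (a) If $\phi$ is affine on the segment $[s_0,s_0+\delta]$, then $$\mathcal L(s_0+\delta)\le\widehat F_{\mathrm J}(\delta),$$ with equality at $\delta=0$. (b) If instead, for constants $B_\phi,L_\phi\ge 0$, the Jacobian of $\phi$ has operator norm at most $B_\phi$ on the segment $[s_0,s_0+\delta]$ and $\lVert\nabla^2\phi_k\rVert\le L_\phi$ on the segment for every output component $k=1,\dots,C$, then $$\mathcal L(s_0+\delta)\le\widehat F_{\mathrm J}(\delta)+O\bigl(L_\phi\lVert\delta\rVert^2\bigr)\quad\text{as }\delta\to 0,$$ and the remainder vanishes when $L_\phi=0$.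
   Context: Setting: the server-side model is fixed, and maps the smashed data (cut-layer activations) $s\in\mathbb R^n$ to the server output $\phi(s)\in\mathbb R^C$. $s_0$ is the smashed data transmitted at the start of the round and $\delta$ the displacement from it. $\phi$ and $\mathcal L_\phi$ are twice continuously differentiable. $\lVert\cdot\rVert$ is the Euclidean norm for vectors and the operator norm for matrices; $A\preceq B$ means $B-A$ is positive semidefinite. Meaning of the asymptotic bound in (b): there are constants $K\ge0$ and $\rho>0$, depending only on $C,M,B_\phi,L_\phi$ and $\lVert\nabla\mathcal L_\phi(\phi(s_0))\rVert$, such that for every $\delta$ with $\lVert\delta\rVert\le\rho$ for which the stated bounds hold on $[s_0,s_0+\delta]$, one has $\mathcal L(s_0+\delta)\le\widehat F_{\mathrm J}(\delta)+K L_\phi\lVert\delta\rVert^2$; and if $L_\phi=0$, then $\mathcal L(s_0+\delta)\le\widehat F_{\mathrm J}(\delta)$. *)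

theory Defs
  imports "HOL-Analysis.Analysis"
begin

(* The constants of the remainder bound are uniform in the input dimension n, so n has to be a term rather
   than a type.  R^n is therefore the carrier of the library space Euclidean_space n: the
   sequences of type nat => real that vanish from index n on, with the topology of pointwise
   convergence.  Indices run over 0,...,n-1, and an array of type nat => nat => real stands for
   a matrix whose size is passed explicitly. *)

abbreviation Rn :: "nat \<Rightarrow> (nat \<Rightarrow> real) set" where
  "Rn n \<equiv> topspace (Euclidean_space n)"

definition enorm :: "nat \<Rightarrow> (nat \<Rightarrow> real) \<Rightarrow> real" where
  "enorm n x = L2_set x {..<n}"

definition einner :: "nat \<Rightarrow> (nat \<Rightarrow> real) \<Rightarrow> (nat \<Rightarrow> real) \<Rightarrow> real" where
  "einner n x y = (\<Sum>i<n. x i * y i)"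

definition mat_vec :: "nat \<Rightarrow> (nat \<Rightarrow> nat \<Rightarrow> real) \<Rightarrow> (nat \<Rightarrow> real) \<Rightarrow> (nat \<Rightarrow> real)" where
  "mat_vec n A v = (\<lambda>k. \<Sum>i<n. A k i * v i)"

(* operator norm of an m x n matrix with respect to the Euclidean norms *)
definition opnorm :: "nat \<Rightarrow> nat \<Rightarrow> (nat \<Rightarrow> nat \<Rightarrow> real) \<Rightarrow> real" where
  "opnorm m n A = (SUP v\<in>{v \<in> Rn n. enorm n v \<le> 1}. enorm m (mat_vec n A v))"

definition id_mat :: "nat \<Rightarrow> nat \<Rightarrow> real" where
  "id_mat i j = (if i = j then 1 else 0)"

definition psd :: "nat \<Rightarrow> (nat \<Rightarrow> nat \<Rightarrow> real) \<Rightarrow> bool" where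
  "psd n A \<longleftrightarrow> (\<forall>i<n. \<forall>j<n. A i j = A j i) \<and> (\<forall>v\<in>Rn n. 0 \<le> einner n v (mat_vec n A v))"

definition loewner_le :: "nat \<Rightarrow> (nat \<Rightarrow> nat \<Rightarrow> real) \<Rightarrow> (nat \<Rightarrow> nat \<Rightarrow> real) \<Rightarrow> bool" where
  "loewner_le n A B \<longleftrightarrow> psd n (\<lambda>i j. B i j - A i j)"

definition partial :: "nat \<Rightarrow> ((nat \<Rightarrow> real) \<Rightarrow> real) \<Rightarrow> (nat \<Rightarrow> real) \<Rightarrow> real" where
  "partial i f x = deriv (\<lambda>t. f (x(i := t))) (x i)"

definition C1 :: "nat \<Rightarrow> ((nat \<Rightarrow> real) \<Rightarrow> real) \<Rightarrow> bool" where
  "C1 n f \<longleftrightarrow> continuous_map (Euclidean_space n) euclideanreal f \<and>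
     (\<forall>i<n. (\<forall>x\<in>Rn n. (\<lambda>t. f (x(i := t))) field_differentiable (at (x i))) \<and>
            continuous_map (Euclidean_space n) euclideanreal (partial i f))"

definition C2 :: "nat \<Rightarrow> ((nat \<Rightarrow> real) \<Rightarrow> real) \<Rightarrow> bool" where
  "C2 n f \<longleftrightarrow> C1 n f \<and> (\<forall>i<n. C1 n (partial i f))"

definition gradient :: "nat \<Rightarrow> ((nat \<Rightarrow> real) \<Rightarrow> real) \<Rightarrow> (nat \<Rightarrow> real) \<Rightarrow> (nat \<Rightarrow> real)" where
  "gradient n f x = (\<lambda>i. if i < n then partial i f x else 0)"

definition hessian :: "((nat \<Rightarrow> real) \<Rightarrow> real) \<Rightarrow> (nat \<Rightarrow> real) \<Rightarrow> nat \<Rightarrow> nat \<Rightarrow> real" where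
  "hessian f x = (\<lambda>i j. partial i (partial j f) x)"

definition jacobian ::
  "((nat \<Rightarrow> real) \<Rightarrow> (nat \<Rightarrow> real)) \<Rightarrow> (nat \<Rightarrow> real) \<Rightarrow> nat \<Rightarrow> nat \<Rightarrow> real" where
  "jacobian \<phi> x = (\<lambda>k i. partial i (\<lambda>y. \<phi> y k) x)"

definition vadd :: "(nat \<Rightarrow> real) \<Rightarrow> (nat \<Rightarrow> real) \<Rightarrow> (nat \<Rightarrow> real)" where
  "vadd x y = (\<lambda>i. x i + y i)"

definition convex_comb :: "real \<Rightarrow> (nat \<Rightarrow> real) \<Rightarrow> (nat \<Rightarrow> real) \<Rightarrow> (nat \<Rightarrow> real)" where
  "convex_comb t x y = (\<lambda>i. (1 - t) * x i + t * y i)"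

definition segment :: "(nat \<Rightarrow> real) \<Rightarrow> (nat \<Rightarrow> real) \<Rightarrow> (nat \<Rightarrow> real) set" where
  "segment x y = (\<lambda>t. convex_comb t x y) ` {0..1}"

definition affine_map_on ::
  "(nat \<Rightarrow> real) set \<Rightarrow> ((nat \<Rightarrow> real) \<Rightarrow> (nat \<Rightarrow> real)) \<Rightarrow> bool" where
  "affine_map_on S \<phi> \<longleftrightarrow>
     (\<forall>x\<in>S. \<forall>y\<in>S. \<forall>t\<in>{0..1}. \<phi> (convex_comb t x y) = convex_comb t (\<phi> x) (\<phi> y))"

(* The standing assumptions; \<phi> is the server output map and \<L> the loss as a function of the
   server output. *)
definition server_model ::
  "nat \<Rightarrow> nat \<Rightarrow> real \<Rightarrow> ((nat \<Rightarrow> real) \<Rightarrow> (nat \<Rightarrow> real)) \<Rightarrow> ((nat \<Rightarrow> real) \<Rightarrow> real) \<Rightarrow> bool" where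
  "server_model n C M \<phi> \<L> \<longleftrightarrow>
     \<phi> \<in> Rn n \<rightarrow> Rn C \<and> (\<forall>k<C. C2 n (\<lambda>s. \<phi> s k)) \<and> C2 C \<L> \<and>
     (\<forall>u\<in>Rn C. loewner_le C (hessian \<L> u) (\<lambda>i j. M * id_mat i j))"

definition gram :: "nat \<Rightarrow> (nat \<Rightarrow> nat \<Rightarrow> real) \<Rightarrow> nat \<Rightarrow> nat \<Rightarrow> real" where
  "gram m J = (\<lambda>i j. \<Sum>k<m. J k i * J k j)"

definition F_J ::
  "nat \<Rightarrow> nat \<Rightarrow> real \<Rightarrow> ((nat \<Rightarrow> real) \<Rightarrow> (nat \<Rightarrow> real)) \<Rightarrow> ((nat \<Rightarrow> real) \<Rightarrow> real) \<Rightarrow>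
   (nat \<Rightarrow> real) \<Rightarrow> (nat \<Rightarrow> real) \<Rightarrow> real" where
  "F_J n C M \<phi> \<L> s0 \<delta> =
     (\<L> \<circ> \<phi>) s0 + einner n (gradient n (\<L> \<circ> \<phi>) s0) \<delta> +
     M / 2 * einner n \<delta> (mat_vec n (gram C (jacobian \<phi> s0)) \<delta>)"

definition derivative_bounds_on ::
  "nat \<Rightarrow> nat \<Rightarrow> real \<Rightarrow> real \<Rightarrow> ((nat \<Rightarrow> real) \<Rightarrow> (nat \<Rightarrow> real)) \<Rightarrow> (nat \<Rightarrow> real) set \<Rightarrow> bool" where
  "derivative_bounds_on n C B L \<phi> S \<longleftrightarrow>
     (\<forall>s\<in>S. opnorm C n (jacobian \<phi> s) \<le> B) \<and>
     (\<forall>k<C. \<forall>s\<in>S. opnorm n n (hessian (\<lambda>x. \<phi> x k) s) \<le> L)"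

end

theory Submission
  imports Defs
begin

(* With d = \<phi>(s0 + \<delta>) - \<phi>(s0), the Hessian bound gives L(\<phi>(s0 + \<delta>)) \<le> L(\<phi>(s0)) + <grad L, d> + M/2 |d|^2
   by Taylor's formula on the segment from \<phi>(s0) to \<phi>(s0 + \<delta>).  By the chain rule F_J is the same
   expression with J \<delta> in place of d, so only r = d - J \<delta> matters: it is zero if \<phi> is affine on the
   segment, and each |r_k| is at most L/2 |\<delta>|^2 if the Hessians of the components are bounded by L. *)

section \<open>Points of \<open>Rn n\<close>, partial derivatives and coordinatewise limits\<close>

lemma mem_Rn: "x \<in> Rn n \<longleftrightarrow> (\<forall>i\<ge>n. x i = 0)"
  by (simp add: topspace_Euclidean_space)

lemma fun_upd_Rn: "x \<in> Rn n \<Longrightarrow> i < n \<Longrightarrow> x(i := t) \<in> Rn n"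
  by (auto simp: mem_Rn)

lemma vadd_Rn: "x \<in> Rn n \<Longrightarrow> y \<in> Rn n \<Longrightarrow> vadd x y \<in> Rn n"
  by (auto simp: mem_Rn vadd_def)

text \<open>\<open>C1\<close> differentiates at the point's own coordinate only. Applied to
  \<open>x(i := a)\<close>, whose coordinate \<open>i\<close> is later overwritten, it gives the
  derivative at an arbitrary \<open>a\<close>.\<close>

lemma C1_partial_DERIV:
  assumes "C1 n f" "i < n" "x \<in> Rn n"
  shows "((\<lambda>t. f (x(i := t))) has_real_derivative partial i f (x(i := a))) (at a)"
proof -
  have "(\<lambda>t. f ((x(i := a))(i := t))) field_differentiable (at ((x(i := a)) i))"
    using assms fun_upd_Rn[of x n i a] unfolding C1_def by blast
  then show ?thesis
    by (simp add: partial_def field_differentiable_derivI)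
qed

text \<open>The topology is inherited from the product topology, so convergence is coordinatewise;
  coordinates from \<open>n\<close> on are constantly zero, which leaves the first \<open>n\<close>
  limits to check. This turns the topological continuity in \<open>C1\<close> into limits along a
  filter.\<close>

lemma tendsto_Euclidean_space:
  assumes f: "continuous_map (Euclidean_space n) euclideanreal f"
    and c: "\<And>t. c t \<in> Rn n" and x: "x \<in> Rn n"
    and lim: "\<And>i. i < n \<Longrightarrow> ((\<lambda>t. c t i) \<longlongrightarrow> x i) F"
  shows "((\<lambda>t. f (c t)) \<longlongrightarrow> f x) F"
proof -
  have "((\<lambda>t. c t i) \<longlongrightarrow> x i) F" for i
  proof (cases "i < n")
    case False
    then show ?thesis using c x by (simp add: mem_Rn)
  qed (use lim in auto)
  then have "limitin (powertop_real UNIV) c x F"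
    by (simp add: limitin_componentwise)
  then have "limitin (Euclidean_space n) c x F"
    using c x by (simp add: Euclidean_space_def limitin_subtopology)
  from continuous_map_limit[OF f this] show ?thesis
    by (simp add: o_def)
qed

section \<open>Mean value theorem and chain rule from continuous partial derivatives\<close>

text \<open>Bounding the distance of \<open>\<xi>\<close> from \<open>a\<close>, instead of placing
  it in an interval, covers both orders of the endpoints and the case \<open>a = b\<close>.\<close>

lemma mvt_between:
  fixes f :: "real \<Rightarrow> real"
  assumes "\<And>t. (f has_real_derivative f' t) (at t)"
  shows "\<exists>\<xi>. \<bar>\<xi> - a\<bar> \<le> \<bar>b - a\<bar> \<and> f b - f a = f' \<xi> * (b - a)"
proof (cases a b rule: linorder_cases)
  case less
  from MVT2[OF less assms] show ?thesis by (force simp: mult.commute)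
next
  case greater
  from MVT2[OF greater assms] obtain z where "b < z" "z < a" "f a - f b = (a - b) * f' z"
    by blast
  then show ?thesis by (intro exI[of _ z]) (auto simp: algebra_simps)
qed auto

text \<open>The path from \<open>x\<close> to \<open>y\<close> changes one coordinate at a time, and
  the one-variable mean value theorem applies to each move. The coordinatewise bound on
  \<open>\<xi> i\<close> forces these points to \<open>x\<close> as \<open>y\<close> tends to
  \<open>x\<close>.\<close>

lemma C1_telescope:
  assumes f: "C1 n f" and x: "x \<in> Rn n" and y: "y \<in> Rn n"
  shows "\<exists>\<xi>. (\<forall>i<n. \<xi> i \<in> Rn n \<and> (\<forall>j. \<bar>\<xi> i j - x j\<bar> \<le> \<bar>y j - x j\<bar>)) \<and>
             f y - f x = (\<Sum>i<n. partial i f (\<xi> i) * (y i - x i))"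
proof -
  \<comment> \<open>\<open>z i\<close> has already taken its first \<open>i\<close> coordinates from
    \<open>y\<close>. Hence \<open>z 0 = x\<close>, and \<open>z n = y\<close> because both points
    vanish from index \<open>n\<close> on.\<close>
  define z where "z i = (\<lambda>j. if j < i then y j else x j)" for i :: nat
  have z_Rn: "z i \<in> Rn n" for i using x y by (auto simp: z_def mem_Rn)
  have "\<exists>\<xi>. \<bar>\<xi> - x i\<bar> \<le> \<bar>y i - x i\<bar> \<and>
          f ((z i)(i := y i)) - f ((z i)(i := x i)) = partial i f ((z i)(i := \<xi>)) * (y i - x i)"
    if "i < n" for i
    using mvt_between[OF C1_partial_DERIV[OF f that z_Rn]] by blast
  then obtain \<xi> where \<xi>: "\<And>i. i < n \<Longrightarrow> \<bar>\<xi> i - x i\<bar> \<le> \<bar>y i - x i\<bar>"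
      "\<And>i. i < n \<Longrightarrow> f ((z i)(i := y i)) - f ((z i)(i := x i)) =
                    partial i f ((z i)(i := \<xi> i)) * (y i - x i)"
    by metis
  have z_ends: "z n = y" "z 0 = x"
    using x y by (auto simp: z_def mem_Rn fun_eq_iff not_less)
  have z_upd: "(z i)(i := y i) = z (Suc i)" "(z i)(i := x i) = z i" for i
    by (auto simp: z_def fun_eq_iff less_Suc_eq)
  have "f y - f x = (\<Sum>i<n. f (z (Suc i)) - f (z i))"
    using sum_lessThan_telescope[of "\<lambda>i. f (z i)" n] by (simp add: z_ends)
  also have "\<dots> = (\<Sum>i<n. partial i f ((z i)(i := \<xi> i)) * (y i - x i))"
    using \<xi>(2) by (intro sum.cong) (auto simp: z_upd)
  finally have "f y - f x = \<dots>" .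
  then show ?thesis
    using \<xi>(1) fun_upd_Rn[OF z_Rn]
    by (intro exI[of _ "\<lambda>i. (z i)(i := \<xi> i)"]) (auto simp: z_def)
qed

text \<open>After division by \<open>t - a\<close>, the telescoped increment is a finite sum of
  partial derivatives at intermediate points times difference quotients. The intermediate points
  tend to \<open>c a\<close>, so continuity of the partial derivatives gives the limit.\<close>

lemma C1_chain:
  assumes f: "C1 n f" and c: "\<And>t. c t \<in> Rn n"
    and d: "\<And>i. i < n \<Longrightarrow> ((\<lambda>t. c t i) has_real_derivative c' i) (at a)"
  shows "((\<lambda>t. f (c t)) has_real_derivative (\<Sum>i<n. partial i f (c a) * c' i)) (at a)"
proof -
  have "\<forall>t. \<exists>\<xi>. (\<forall>i<n. \<xi> i \<in> Rn n \<and> (\<forall>j. \<bar>\<xi> i j - c a j\<bar> \<le> \<bar>c t j - c a j\<bar>)) \<and>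
             f (c t) - f (c a) = (\<Sum>i<n. partial i f (\<xi> i) * (c t i - c a i))"
    using C1_telescope[OF f c c] by simp
  then obtain \<xi> where "\<forall>t. (\<forall>i<n. \<xi> t i \<in> Rn n \<and> (\<forall>j. \<bar>\<xi> t i j - c a j\<bar> \<le> \<bar>c t j - c a j\<bar>)) \<and>
             f (c t) - f (c a) = (\<Sum>i<n. partial i f (\<xi> t i) * (c t i - c a i))"
    by (rule choice[THEN exE])
  then have \<xi>: "\<And>t i. i < n \<Longrightarrow> \<xi> t i \<in> Rn n"
      "\<And>t i j. i < n \<Longrightarrow> \<bar>\<xi> t i j - c a j\<bar> \<le> \<bar>c t j - c a j\<bar>"
      "\<And>t. f (c t) - f (c a) = (\<Sum>i<n. partial i f (\<xi> t i) * (c t i - c a i))"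
    by simp_all
  have "((\<lambda>t. partial i f (\<xi> t i)) \<longlongrightarrow> partial i f (c a)) (at a)" if i: "i < n" for i
  proof (rule tendsto_Euclidean_space[where n = n and c = "\<lambda>t. \<xi> t i"])
    show "continuous_map (Euclidean_space n) euclideanreal (partial i f)"
      using f i by (simp add: C1_def)
    fix j assume "j < n"
    then have "((\<lambda>t. c t j - c a j) \<longlongrightarrow> 0) (at a)"
      using DERIV_isCont[OF d] LIM_zero by (auto simp: isCont_def)
    \<comment> \<open>Squeezed by the distance of \<open>c t j\<close> from \<open>c a j\<close>,
      which tends to zero since \<open>c\<close> is differentiable at \<open>a\<close>.\<close>
    then have "((\<lambda>t. \<xi> t i j - c a j) \<longlongrightarrow> 0) (at a)"
      by (rule Lim_null_comparison[rotated, OF tendsto_rabs_zero]) (simp add: \<xi>(2)[OF i])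
    then show "((\<lambda>t. \<xi> t i j) \<longlongrightarrow> c a j) (at a)"
      by (rule LIM_zero_cancel)
  qed (use \<xi>(1) i c in auto)
  moreover have "((\<lambda>t. (c t i - c a i) / (t - a)) \<longlongrightarrow> c' i) (at a)" if "i < n" for i
    using d[OF that] by (simp add: has_field_derivative_iff)
  ultimately have "((\<lambda>t. \<Sum>i<n. partial i f (\<xi> t i) * ((c t i - c a i) / (t - a)))
      \<longlongrightarrow> (\<Sum>i<n. partial i f (c a) * c' i)) (at a)"
    by (intro tendsto_sum tendsto_mult) auto
  then show ?thesis
    by (simp add: has_field_derivative_iff \<xi>(3) sum_divide_distrib)
qed

section \<open>Second-order Taylor formula along a line\<close>

text \<open>The parameter runs over all reals, so two-sided derivatives make sense at the ends
  \<open>t = 0\<close> and \<open>t = 1\<close> of the segment.\<close>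

definition line :: "(nat \<Rightarrow> real) \<Rightarrow> (nat \<Rightarrow> real) \<Rightarrow> real \<Rightarrow> nat \<Rightarrow> real" where
  "line x d t = (\<lambda>i. x i + t * d i)"

lemma line_Rn: "x \<in> Rn n \<Longrightarrow> d \<in> Rn n \<Longrightarrow> line x d t \<in> Rn n"
  by (auto simp: mem_Rn line_def)

lemma line_0: "line x d 0 = x" and line_1: "line x d 1 = vadd x d"
  by (auto simp: line_def vadd_def)

lemma convex_comb_vadd: "convex_comb t x (vadd x d) = line x d t"
  by (auto simp: convex_comb_def vadd_def line_def algebra_simps)

lemma C1_line_DERIV:
  assumes "C1 n f" "x \<in> Rn n" "d \<in> Rn n"
  shows "((\<lambda>t. f (line x d t)) has_real_derivative (\<Sum>i<n. partial i f (line x d t) * d i)) (at t)"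
proof (rule C1_chain[where n = n and c = "line x d"])
  show "((\<lambda>t. line x d t i) has_real_derivative d i) (at t)" for i
    unfolding line_def by (auto intro!: derivative_eq_intros)
qed (use assms line_Rn in auto)

text \<open>Maclaurin expansion of order two, with Lagrange remainder, of the restriction of
  \<open>f\<close> to the line, evaluated at parameter 1.\<close>

lemma C2_line_taylor:
  assumes f: "C2 n f" and x: "x \<in> Rn n" and d: "d \<in> Rn n"
  shows "\<exists>t. 0 < t \<and> t < 1 \<and> f (vadd x d) =
           f x + einner n (gradient n f x) d +
           einner n d (mat_vec n (hessian f (line x d t)) d) / 2"
proof -
  let ?H = "\<lambda>t. \<Sum>i<n. (\<Sum>j<n. partial j (partial i f) (line x d t) * d j) * d i"
  define D where "D m = (if m = 0 then \<lambda>t. f (line x d t)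
      else if m = 1 then \<lambda>t. \<Sum>i<n. partial i f (line x d t) * d i else ?H)" for m :: nat
  have f1: "C1 n f" "\<And>i. i < n \<Longrightarrow> C1 n (partial i f)"
    using f by (auto simp: C2_def)
  have D1: "(D 0 has_real_derivative D 1 t) (at t)" for t
    using C1_line_DERIV[OF f1(1) x d] by (simp add: D_def)
  have D2: "(D 1 has_real_derivative D 2 t) (at t)" for t
    unfolding D_def
    by (auto intro!: derivative_eq_intros C1_line_DERIV[OF f1(2) x d])
  have "\<exists>t>0. t < 1 \<and> D 0 1 = (\<Sum>m<2. D m 0 / fact m * 1 ^ m) + D 2 t / fact 2 * 1 ^ 2"
  proof (rule Maclaurin)
    show "\<forall>m t. m < 2 \<and> 0 \<le> t \<and> t \<le> 1 \<longrightarrow> (D m has_real_derivative D (Suc m) t) (at t)"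
      using D1 D2 by (auto simp: numeral_2_eq_2 less_Suc_eq)
  qed auto
  then obtain t where t: "0 < t" "t < 1" "D 0 1 = D 0 0 + D 1 0 + D 2 t / 2"
    by (auto simp: numeral_2_eq_2)
  have "D 2 t = (\<Sum>i<n. \<Sum>j<n. partial j (partial i f) (line x d t) * d j * d i)"
    by (simp add: D_def sum_distrib_right)
  \<comment> \<open>Differentiating along the line produces \<open>partial j (partial i f)\<close>;
    exchanging the sums restores the index order used in \<open>hessian\<close>.\<close>
  also have "\<dots> = einner n d (mat_vec n (hessian f (line x d t)) d)"
    by (subst sum.swap)
      (simp add: einner_def mat_vec_def hessian_def sum_distrib_left mult_ac)
  finally have "D 2 t = \<dots>" .
  with t show ?thesis
    by (intro exI[of _ t]) (simp add: D_def line_0 line_1 einner_def gradient_def)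
qed

section \<open>Euclidean norm, operator norm and quadratic forms\<close>

lemma enorm_nonneg: "0 \<le> enorm n x"
  by (simp add: enorm_def L2_set_nonneg)

lemma enorm_power2: "(enorm n x)\<^sup>2 = einner n x x"
  by (simp add: enorm_def L2_set_def einner_def power2_eq_square sum_nonneg)

lemma abs_einner_le: "\<bar>einner n x y\<bar> \<le> enorm n x * enorm n y"
proof -
  have "\<bar>einner n x y\<bar> \<le> (\<Sum>i<n. \<bar>x i\<bar> * \<bar>y i\<bar>)"
    unfolding einner_def by (rule order_trans[OF sum_abs]) (simp add: abs_mult)
  also have "\<dots> \<le> enorm n x * enorm n y"
    unfolding enorm_def by (rule L2_set_mult_ineq)
  finally show ?thesis .
qed

lemma abs_le_enorm: "i < n \<Longrightarrow> \<bar>x i\<bar> \<le> enorm n x"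
  using member_le_L2_set[of "{..<n}" i "\<lambda>i. \<bar>x i\<bar>"] by (simp add: enorm_def L2_set_def)

lemma enorm_le_sum: "enorm n x \<le> (\<Sum>i<n. \<bar>x i\<bar>)"
  unfolding enorm_def by (rule L2_set_le_sum_abs)

lemma enorm_scale: "enorm n (\<lambda>i. c * x i) = \<bar>c\<bar> * enorm n x"
  by (simp add: enorm_def L2_set_def power_mult_distrib sum_distrib_left[symmetric]
      real_sqrt_mult)

text \<open>By homogeneity it suffices to rescale \<open>v\<close> to norm one, where the supremum
  in \<open>opnorm\<close> applies.\<close>

lemma enorm_mat_vec_le:
  assumes v: "v \<in> Rn n"
  shows "enorm m (mat_vec n A v) \<le> opnorm m n A * enorm n v"
proof (cases "enorm n v = 0")
  case True
  then have "v i = 0" if "i < n" for i using abs_le_enorm[OF that, of v] by simp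
  then have "mat_vec n A v = (\<lambda>k. 0)" by (simp add: mat_vec_def)
  with True show ?thesis by (simp add: enorm_def L2_set_def)
next
  case False
  with enorm_nonneg[of n v] have pos: "0 < enorm n v" by simp
  let ?c = "inverse (enorm n v)"
  let ?w = "\<lambda>i. ?c * v i"
  have w: "?w \<in> Rn n" "enorm n ?w \<le> 1"
    using v pos by (auto simp: mem_Rn enorm_scale)
  \<comment> \<open>A real supremum dominates the members of the set only once the set is known to
    be bounded. On the unit ball every coordinate has modulus at most 1, so the sum of the absolute
    entries is a bound.\<close>
  have bdd: "bdd_above ((\<lambda>v. enorm m (mat_vec n A v)) ` {v \<in> Rn n. enorm n v \<le> 1})"
  proof (rule bdd_aboveI2[where M = "\<Sum>k<m. \<Sum>i<n. \<bar>A k i\<bar>"])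
    fix u assume u: "u \<in> {v \<in> Rn n. enorm n v \<le> 1}"
    have "enorm m (mat_vec n A u) \<le> (\<Sum>k<m. \<bar>mat_vec n A u k\<bar>)"
      by (rule enorm_le_sum)
    also have "\<dots> \<le> (\<Sum>k<m. \<Sum>i<n. \<bar>A k i\<bar>)"
    proof (rule sum_mono)
      fix k
      have "\<bar>A k i * u i\<bar> \<le> \<bar>A k i\<bar>" if "i < n" for i
        using abs_le_enorm[OF that, of u] u by (simp add: abs_mult mult_left_le)
      then show "\<bar>mat_vec n A u k\<bar> \<le> (\<Sum>i<n. \<bar>A k i\<bar>)"
        unfolding mat_vec_def by (intro order_trans[OF sum_abs] sum_mono) auto
    qed
    finally show "enorm m (mat_vec n A u) \<le> (\<Sum>k<m. \<Sum>i<n. \<bar>A k i\<bar>)" .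
  qed
  have "enorm m (mat_vec n A ?w) \<le> opnorm m n A"
    unfolding opnorm_def by (rule cSUP_upper[OF _ bdd]) (use w in auto)
  moreover have "mat_vec n A ?w = (\<lambda>k. ?c * mat_vec n A v k)"
    by (simp add: mat_vec_def sum_distrib_left mult_ac)
  ultimately have "?c * enorm m (mat_vec n A v) \<le> opnorm m n A"
    using pos by (simp only: enorm_scale) simp
  with pos show ?thesis by (simp add: field_simps)
qed

lemma abs_quadratic_form_le:
  assumes "v \<in> Rn n"
  shows "\<bar>einner n v (mat_vec n A v)\<bar> \<le> opnorm n n A * (enorm n v)\<^sup>2"
proof -
  have "\<bar>einner n v (mat_vec n A v)\<bar> \<le> enorm n v * enorm n (mat_vec n A v)"
    by (rule abs_einner_le)
  also have "\<dots> \<le> enorm n v * (opnorm n n A * enorm n v)"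
    by (intro mult_left_mono enorm_mat_vec_le assms enorm_nonneg)
  finally show ?thesis by (simp add: power2_eq_square mult_ac)
qed

lemma loewner_le_quadratic_form:
  assumes "loewner_le n A (\<lambda>i j. M * id_mat i j)" and v: "v \<in> Rn n"
  shows "einner n v (mat_vec n A v) \<le> M * einner n v v"
proof -
  have "0 \<le> einner n v (mat_vec n (\<lambda>i j. M * id_mat i j - A i j) v)"
    using assms by (auto simp: loewner_le_def psd_def)
  also have "\<dots> = einner n v (mat_vec n (\<lambda>i j. M * id_mat i j) v) - einner n v (mat_vec n A v)"
    by (simp add: einner_def mat_vec_def algebra_simps sum_subtractf)
  also have "einner n v (mat_vec n (\<lambda>i j. M * id_mat i j) v) = M * einner n v v"
    by (simp add: einner_def mat_vec_def id_mat_def if_distrib if_distribR sum_distrib_left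
        mult_ac cong: if_cong)
  finally show ?thesis by simp
qed

section \<open>Quadratic upper bound for the composed loss\<close>

text \<open>The Hessian in the Taylor remainder is taken at an unknown point of the line; the bound
  holds on all of \<open>Rn n\<close>, hence there too.\<close>

lemma C2_upper_quadratic:
  assumes f: "C2 n f" and H: "\<forall>u\<in>Rn n. loewner_le n (hessian f u) (\<lambda>i j. M * id_mat i j)"
    and x: "x \<in> Rn n" and d: "d \<in> Rn n"
  shows "f (vadd x d) \<le> f x + einner n (gradient n f x) d + M / 2 * einner n d d"
proof -
  obtain t where "f (vadd x d) = f x + einner n (gradient n f x) d +
           einner n d (mat_vec n (hessian f (line x d t)) d) / 2"
    using C2_line_taylor[OF f x d] by blast
  with loewner_le_quadratic_form[OF _ d, of "hessian f (line x d t)" M] H line_Rn[OF x d]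
  show ?thesis by force
qed

text \<open>The gradient of the composition is the transposed Jacobian applied to the outer
  gradient; the inner product moves the Jacobian onto \<open>d\<close>.\<close>

lemma gradient_comp:
  assumes \<phi>: "\<phi> \<in> Rn n \<rightarrow> Rn C" "\<And>k. k < C \<Longrightarrow> C1 n (\<lambda>s. \<phi> s k)" and f: "C1 C f"
    and x: "x \<in> Rn n"
  shows "einner n (gradient n (f \<circ> \<phi>) x) d =
         einner C (gradient C f (\<phi> x)) (mat_vec n (jacobian \<phi> x) d)"
proof -
  have p: "partial i (f \<circ> \<phi>) x = (\<Sum>k<C. partial k f (\<phi> x) * jacobian \<phi> x k i)" if i: "i < n" for i
  proof -
    \<comment> \<open>Chain rule in \<open>Rn C\<close> along the image under \<open>\<phi>\<close>
      of the \<open>i\<close>-th coordinate line through \<open>x\<close>.\<close>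
    have "((\<lambda>t. f (\<phi> (x(i := t)))) has_real_derivative
        (\<Sum>k<C. partial k f (\<phi> (x(i := x i))) * jacobian \<phi> x k i)) (at (x i))"
      using C1_partial_DERIV[OF \<phi>(2) i x, of _ "x i"] fun_upd_Rn[OF x i] \<phi>(1)
      by (intro C1_chain[OF f]) (auto simp: jacobian_def)
    then show ?thesis by (simp add: partial_def[of i] DERIV_imp_deriv)
  qed
  have "einner n (gradient n (f \<circ> \<phi>) x) d =
        (\<Sum>i<n. \<Sum>k<C. partial k f (\<phi> x) * jacobian \<phi> x k i * d i)"
    by (simp add: einner_def gradient_def p sum_distrib_right)
  then show ?thesis
    by (subst (asm) sum.swap)
      (simp add: einner_def gradient_def mat_vec_def sum_distrib_left mult_ac)
qed

text \<open>Identifies the quadratic term of \<open>F_J\<close> as \<open>M / 2\<close> times the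
  squared norm of the linearised output displacement.\<close>

lemma gram_quadratic_form:
  "einner n d (mat_vec n (gram m J) d) = einner m (mat_vec n J d) (mat_vec n J d)"
proof -
  have "einner n d (mat_vec n (gram m J) d) = (\<Sum>i<n. \<Sum>j<n. \<Sum>k<m. J k i * d i * (J k j * d j))"
    by (simp add: einner_def mat_vec_def gram_def sum_distrib_left sum_distrib_right mult_ac)
  also have "\<dots> = (\<Sum>i<n. \<Sum>k<m. \<Sum>j<n. J k i * d i * (J k j * d j))"
    by (intro sum.cong refl sum.swap)
  also have "\<dots> = (\<Sum>k<m. \<Sum>i<n. \<Sum>j<n. J k i * d i * (J k j * d j))"
    by (rule sum.swap)
  also have "\<dots> = einner m (mat_vec n J d) (mat_vec n J d)"
    by (simp add: einner_def mat_vec_def sum_product)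
  finally show ?thesis .
qed

text \<open>The output displacement is \<open>Jd + r\<close>. In the quadratic bound for
  \<open>\<L>\<close>, the terms free of \<open>r\<close> reassemble to \<open>F_J\<close>; the
  three others isolate the error of linearising \<open>\<phi>\<close>, so both claims reduce to
  estimates of \<open>r\<close>.\<close>

lemma server_model_bound:
  fixes n :: nat and \<phi> s0 \<delta>
  defines "Jd \<equiv> mat_vec n (jacobian \<phi> s0) \<delta>"
  defines "r \<equiv> \<lambda>k. \<phi> (vadd s0 \<delta>) k - \<phi> s0 k - Jd k"
  assumes m: "server_model n C M \<phi> \<L>" and s0: "s0 \<in> Rn n" and \<delta>: "\<delta> \<in> Rn n"
  shows "(\<L> \<circ> \<phi>) (vadd s0 \<delta>) \<le> F_J n C M \<phi> \<L> s0 \<delta> +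
           einner C (gradient C \<L> (\<phi> s0)) r + M * einner C Jd r + M / 2 * einner C r r"
proof -
  define d where "d = (\<lambda>k. \<phi> (vadd s0 \<delta>) k - \<phi> s0 k)"
  have \<phi>: "\<phi> s0 \<in> Rn C" "\<phi> (vadd s0 \<delta>) \<in> Rn C"
    using m s0 vadd_Rn[OF s0 \<delta>] by (auto simp: server_model_def)
  then have "d \<in> Rn C" "vadd (\<phi> s0) d = \<phi> (vadd s0 \<delta>)"
    by (auto simp: mem_Rn d_def vadd_def)
  then have "(\<L> \<circ> \<phi>) (vadd s0 \<delta>) \<le>
      \<L> (\<phi> s0) + einner C (gradient C \<L> (\<phi> s0)) d + M / 2 * einner C d d"
    using C2_upper_quadratic[of C \<L> M "\<phi> s0" d] m \<phi>(1) by (simp add: server_model_def)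
  moreover have "d = (\<lambda>k. Jd k + r k)" by (simp add: r_def d_def)
  moreover have "einner C (gradient C \<L> (\<phi> s0)) (\<lambda>k. Jd k + r k) =
      einner n (gradient n (\<L> \<circ> \<phi>) s0) \<delta> + einner C (gradient C \<L> (\<phi> s0)) r"
  proof -
    have "einner n (gradient n (\<L> \<circ> \<phi>) s0) \<delta> = einner C (gradient C \<L> (\<phi> s0)) Jd"
      unfolding Jd_def using m s0
      by (intro gradient_comp) (auto simp: server_model_def C2_def)
    then show ?thesis by (simp add: einner_def algebra_simps sum.distrib)
  qed
  moreover have "einner C (\<lambda>k. Jd k + r k) (\<lambda>k. Jd k + r k) =
      einner C Jd Jd + 2 * einner C Jd r + einner C r r"
    by (simp add: einner_def algebra_simps sum.distrib sum_distrib_left)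
  ultimately show ?thesis
    by (simp add: F_J_def gram_quadratic_form Jd_def algebra_simps add_divide_distrib)
qed

section \<open>Linearisation error of the server map and the resulting bounds\<close>

text \<open>Affinity makes the difference quotient along the segment constant and equal to the full
  increment, while its limit at the start is the Jacobian applied to \<delta>.\<close>

lemma affine_remainder_eq_0:
  assumes \<phi>: "C1 n (\<lambda>s. \<phi> s k)" and s0: "s0 \<in> Rn n" and \<delta>: "\<delta> \<in> Rn n"
    and aff: "affine_map_on (segment s0 (vadd s0 \<delta>)) \<phi>"
  shows "\<phi> (vadd s0 \<delta>) k - \<phi> s0 k = mat_vec n (jacobian \<phi> s0) \<delta> k"
proof -
  have seg: "line s0 \<delta> t \<in> segment s0 (vadd s0 \<delta>)" if "t \<in> {0..1}" for t
    using that by (auto simp: segment_def convex_comb_vadd)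
  have "\<phi> (line s0 \<delta> t) k = \<phi> s0 k + t * (\<phi> (vadd s0 \<delta>) k - \<phi> s0 k)" if t: "t \<in> {0..1}" for t
  proof -
    have "\<phi> (convex_comb t s0 (vadd s0 \<delta>)) = convex_comb t (\<phi> s0) (\<phi> (vadd s0 \<delta>))"
      using aff seg[of 0] seg[of 1] t by (simp add: affine_map_on_def line_0 line_1)
    then show ?thesis
      by (simp add: convex_comb_vadd) (simp add: convex_comb_def algebra_simps)
  qed
  \<comment> \<open>Affinity is known only for parameters in [0,1], hence the limit from the right
    at 0.\<close>
  then have "eventually (\<lambda>t. (\<phi> (line s0 \<delta> t) k - \<phi> (line s0 \<delta> 0) k) / (t - 0) =
      \<phi> (vadd s0 \<delta>) k - \<phi> s0 k) (at_right 0)"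
    unfolding eventually_at_right_field by (intro exI[of _ 1]) (auto simp: line_0)
  then have "((\<lambda>t. (\<phi> (line s0 \<delta> t) k - \<phi> (line s0 \<delta> 0) k) / (t - 0)) \<longlongrightarrow>
      \<phi> (vadd s0 \<delta>) k - \<phi> s0 k) (at_right 0)"
    by (rule tendsto_eventually)
  moreover have "((\<lambda>t. (\<phi> (line s0 \<delta> t) k - \<phi> (line s0 \<delta> 0) k) / (t - 0)) \<longlongrightarrow>
      mat_vec n (jacobian \<phi> s0) \<delta> k) (at_right 0)"
    using has_field_derivative_at_within[OF C1_line_DERIV[OF \<phi> s0 \<delta>, of 0], of "{0<..}"]
    by (simp add: has_field_derivative_iff mat_vec_def jacobian_def line_0)
  ultimately show ?thesis
    using tendsto_unique trivial_limit_at_right_real by blast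
qed

text \<open>Taylor's formula for one component: the intermediate point lies on the segment, so the
  operator norm bound controls the quadratic form there.\<close>

lemma hessian_remainder_le:
  assumes \<phi>: "C2 n (\<lambda>s. \<phi> s k)" and s0: "s0 \<in> Rn n" and \<delta>: "\<delta> \<in> Rn n"
    and H: "\<And>s. s \<in> segment s0 (vadd s0 \<delta>) \<Longrightarrow> opnorm n n (hessian (\<lambda>x. \<phi> x k) s) \<le> L"
  shows "\<bar>\<phi> (vadd s0 \<delta>) k - \<phi> s0 k - mat_vec n (jacobian \<phi> s0) \<delta> k\<bar> \<le> L / 2 * (enorm n \<delta>)\<^sup>2"
proof -
  obtain t where t: "0 < t" "t < 1" and eq: "\<phi> (vadd s0 \<delta>) k =
      \<phi> s0 k + einner n (gradient n (\<lambda>s. \<phi> s k) s0) \<delta> +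
      einner n \<delta> (mat_vec n (hessian (\<lambda>s. \<phi> s k) (line s0 \<delta> t)) \<delta>) / 2" (is "_ = _ + ?g + ?q / 2")
    using C2_line_taylor[OF \<phi> s0 \<delta>] by blast
  have "?g = mat_vec n (jacobian \<phi> s0) \<delta> k"
    by (simp add: einner_def gradient_def mat_vec_def jacobian_def)
  moreover have "\<bar>?q\<bar> \<le> L * (enorm n \<delta>)\<^sup>2"
  proof (rule order_trans[OF abs_quadratic_form_le[OF \<delta>]], rule mult_right_mono[OF H])
    show "line s0 \<delta> t \<in> segment s0 (vadd s0 \<delta>)"
      using t by (auto simp: segment_def convex_comb_vadd)
  qed simp
  ultimately show ?thesis using eq by simp
qed

text \<open>Cauchy-Schwarz on the three terms containing \<open>r\<close>. Only the \<open>C\<close>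
  output components are summed, so the constant is free of \<open>n\<close>; the explicit factor
  \<open>L\<close> makes the remainder vanish for \<open>L = 0\<close>.\<close>

lemma server_model_remainder:
  assumes m: "server_model n C M \<phi> \<L>" and s0: "s0 \<in> Rn n" and \<delta>: "\<delta> \<in> Rn n"
    and B: "0 \<le> B" and L: "0 \<le> L" and \<delta>1: "enorm n \<delta> \<le> 1"
    and bd: "derivative_bounds_on n C B L \<phi> (segment s0 (vadd s0 \<delta>))"
  shows "(\<L> \<circ> \<phi>) (vadd s0 \<delta>) \<le> F_J n C M \<phi> \<L> s0 \<delta> +
     C * (enorm C (gradient C \<L> (\<phi> s0)) + \<bar>M\<bar> * (B + C * L)) * L * (enorm n \<delta>)\<^sup>2"
proof -
  define Jd where "Jd = mat_vec n (jacobian \<phi> s0) \<delta>"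
  define r where "r = (\<lambda>k. \<phi> (vadd s0 \<delta>) k - \<phi> s0 k - Jd k)"
  define g where "g = gradient C \<L> (\<phi> s0)"
  \<comment> \<open>Bound for the norm of \<open>r\<close>: \<open>C\<close> components, each at
    most \<open>L\<close> times the squared norm of \<delta>, the Taylor factor 1/2 being given
    away.\<close>
  define R where "R = C * L * (enorm n \<delta>)\<^sup>2"
  note nn = enorm_nonneg[of C g] enorm_nonneg[of C r] enorm_nonneg[of C Jd] enorm_nonneg[of n \<delta>]
  have \<delta>2: "(enorm n \<delta>)\<^sup>2 \<le> 1" using nn(4) \<delta>1 by (simp add: power_le_one)
  have "\<bar>r k\<bar> \<le> L * (enorm n \<delta>)\<^sup>2" if "k < C" for k
  proof -
    have "\<bar>r k\<bar> \<le> L / 2 * (enorm n \<delta>)\<^sup>2"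
      unfolding r_def Jd_def using m bd that
      by (intro hessian_remainder_le s0 \<delta>) (auto simp: server_model_def derivative_bounds_on_def)
    also have "\<dots> \<le> L * (enorm n \<delta>)\<^sup>2" using L by (intro mult_right_mono) auto
    finally show ?thesis .
  qed
  then have "(\<Sum>k<C. \<bar>r k\<bar>) \<le> (\<Sum>k<C. L * (enorm n \<delta>)\<^sup>2)"
    by (intro sum_mono) auto
  with enorm_le_sum[of C r] have rR: "enorm C r \<le> R"
    by (simp add: R_def mult_ac)
  \<comment> \<open>The second inequality uses that \<delta> has norm at most 1. It bounds one
    factor of the term quadratic in \<open>r\<close> by \<open>C * L\<close>, so that this term too
    is linear in \<open>R\<close>.\<close>
  have R: "0 \<le> R" "R \<le> C * L"
    using L \<delta>2 by (auto simp: R_def mult_left_le)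
  have Jd: "enorm C Jd \<le> B"
  proof -
    have "s0 \<in> segment s0 (vadd s0 \<delta>)"
      unfolding segment_def by (rule image_eqI[of _ _ 0]) (auto simp: convex_comb_def)
    then have "opnorm C n (jacobian \<phi> s0) \<le> B"
      using bd by (auto simp: derivative_bounds_on_def)
    then have "opnorm C n (jacobian \<phi> s0) * enorm n \<delta> \<le> B * 1"
      using nn(4) \<delta>1 B by (intro mult_mono) auto
    with enorm_mat_vec_le[OF \<delta>, of C "jacobian \<phi> s0"] show ?thesis by (simp add: Jd_def)
  qed
  have "einner C g r \<le> enorm C g * R"
    using abs_einner_le[of C g r] mult_left_mono[OF rR nn(1)] by linarith
  moreover have "M * einner C Jd r \<le> \<bar>M\<bar> * (B * R)"
  proof -
    have "M * einner C Jd r \<le> \<bar>M\<bar> * \<bar>einner C Jd r\<bar>" by (metis abs_ge_self abs_mult)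
    also have "\<bar>einner C Jd r\<bar> \<le> B * R"
      using abs_einner_le[of C Jd r] mult_mono[OF Jd rR B nn(2)] by linarith
    finally show ?thesis by (simp add: mult_left_mono)
  qed
  moreover have "M / 2 * einner C r r \<le> \<bar>M\<bar> * (C * L * R)"
  proof -
    have "M / 2 * einner C r r \<le> \<bar>M\<bar> * (enorm C r * enorm C r)"
      unfolding enorm_power2[symmetric] power2_eq_square by (intro mult_right_mono) auto
    also have "\<dots> \<le> \<bar>M\<bar> * (C * L * R)"
      using rR R nn(2) L by (intro mult_left_mono mult_mono) auto
    finally show ?thesis .
  qed
  moreover have "(\<L> \<circ> \<phi>) (vadd s0 \<delta>) \<le> F_J n C M \<phi> \<L> s0 \<delta> +
      einner C g r + M * einner C Jd r + M / 2 * einner C r r"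
    unfolding g_def r_def Jd_def by (rule server_model_bound[OF m s0 \<delta>])
  ultimately have "(\<L> \<circ> \<phi>) (vadd s0 \<delta>) \<le> F_J n C M \<phi> \<L> s0 \<delta> +
      (enorm C g * R + \<bar>M\<bar> * (B * R) + \<bar>M\<bar> * (C * L * R))"
    by linarith
  also have "enorm C g * R + \<bar>M\<bar> * (B * R) + \<bar>M\<bar> * (C * L * R) =
      C * (enorm C g + \<bar>M\<bar> * (B + C * L)) * L * (enorm n \<delta>)\<^sup>2"
    by (simp add: R_def algebra_simps)
  finally show ?thesis by (simp add: g_def)
qed

lemma server_model_affine:
  assumes m: "server_model n C M \<phi> \<L>" and s0: "s0 \<in> Rn n" and \<delta>: "\<delta> \<in> Rn n"
    and aff: "affine_map_on (segment s0 (vadd s0 \<delta>)) \<phi>"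
  shows "(\<L> \<circ> \<phi>) (vadd s0 \<delta>) \<le> F_J n C M \<phi> \<L> s0 \<delta>"
proof -
  have "\<phi> (vadd s0 \<delta>) k - \<phi> s0 k - mat_vec n (jacobian \<phi> s0) \<delta> k = 0" if "k < C" for k
    using affine_remainder_eq_0[OF _ s0 \<delta> aff, of k] m that
    by (auto simp: server_model_def C2_def)
  then show ?thesis
    using server_model_bound[OF m s0 \<delta>] by (simp add: einner_def)
qed

lemma F_J_0: "F_J n C M \<phi> \<L> s0 (\<lambda>i. 0) = (\<L> \<circ> \<phi>) (vadd s0 (\<lambda>i. 0))"
  by (simp add: F_J_def einner_def vadd_def)

theorem proposition2:
  shows
    "(\<forall>(n::nat) (C::nat) (M::real) \<phi> \<L> s0. server_model n C M \<phi> \<L> \<longrightarrow> s0 \<in> Rn n \<longrightarrow>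
        (\<forall>\<delta>\<in>Rn n. affine_map_on (segment s0 (vadd s0 \<delta>)) \<phi> \<longrightarrow>
           (\<L> \<circ> \<phi>) (vadd s0 \<delta>) \<le> F_J n C M \<phi> \<L> s0 \<delta>) \<and>
        (\<L> \<circ> \<phi>) (vadd s0 (\<lambda>i. 0)) = F_J n C M \<phi> \<L> s0 (\<lambda>i. 0))
     \<and>
     (\<forall>(C::nat) (M::real) (B::real) (L::real) (G::real). 0 \<le> B \<longrightarrow> 0 \<le> L \<longrightarrow>
        (\<exists>K \<rho>. 0 \<le> K \<and> 0 < \<rho> \<and>
          (\<forall>(n::nat) \<phi> \<L> s0. server_model n C M \<phi> \<L> \<longrightarrow> s0 \<in> Rn n \<longrightarrow>
             enorm C (gradient C \<L> (\<phi> s0)) = G \<longrightarrow>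
             (\<forall>\<delta>\<in>Rn n. enorm n \<delta> \<le> \<rho> \<longrightarrow>
                derivative_bounds_on n C B L \<phi> (segment s0 (vadd s0 \<delta>)) \<longrightarrow>
                (\<L> \<circ> \<phi>) (vadd s0 \<delta>) \<le> F_J n C M \<phi> \<L> s0 \<delta> + K * L * (enorm n \<delta>)\<^sup>2 \<and>
                (L = 0 \<longrightarrow> (\<L> \<circ> \<phi>) (vadd s0 \<delta>) \<le> F_J n C M \<phi> \<L> s0 \<delta>)))))"
proof (intro conjI allI impI ballI)
  fix C :: nat and M B L G :: real
  assume B: "0 \<le> B" and L: "0 \<le> L"
  \<comment> \<open>\<open>G\<close> ranges over all reals before any model is fixed, so
    \<open>\<bar>G\<bar>\<close> secures \<open>0 \<le> ?K\<close> even for negative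
    \<open>G\<close>; whenever a model attains \<open>G\<close>, it is a norm and the two
    agree.\<close>
  let ?K = "C * (\<bar>G\<bar> + \<bar>M\<bar> * (B + C * L))"
  have bound: "(\<L> \<circ> \<phi>) (vadd s0 \<delta>) \<le> F_J n C M \<phi> \<L> s0 \<delta> + ?K * L * (enorm n \<delta>)\<^sup>2"
    if "server_model n C M \<phi> \<L>" "s0 \<in> Rn n" "enorm C (gradient C \<L> (\<phi> s0)) = G" "\<delta> \<in> Rn n"
      "enorm n \<delta> \<le> 1" "derivative_bounds_on n C B L \<phi> (segment s0 (vadd s0 \<delta>))"
    for n \<phi> \<L> s0 \<delta>
  proof -
    have "G = \<bar>G\<bar>" using that(3) enorm_nonneg[of C] by (metis abs_of_nonneg)
    then show ?thesis
      using server_model_remainder[OF that(1,2,4) B L that(5,6)] that(3) by simp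
  qed
  have K: "0 \<le> ?K" using B L by simp
  show "\<exists>K \<rho>. 0 \<le> K \<and> 0 < \<rho> \<and>
          (\<forall>(n::nat) \<phi> \<L> s0. server_model n C M \<phi> \<L> \<longrightarrow> s0 \<in> Rn n \<longrightarrow>
             enorm C (gradient C \<L> (\<phi> s0)) = G \<longrightarrow>
             (\<forall>\<delta>\<in>Rn n. enorm n \<delta> \<le> \<rho> \<longrightarrow>
                derivative_bounds_on n C B L \<phi> (segment s0 (vadd s0 \<delta>)) \<longrightarrow>
                (\<L> \<circ> \<phi>) (vadd s0 \<delta>) \<le> F_J n C M \<phi> \<L> s0 \<delta> + K * L * (enorm n \<delta>)\<^sup>2 \<and>
                (L = 0 \<longrightarrow> (\<L> \<circ> \<phi>) (vadd s0 \<delta>) \<le> F_J n C M \<phi> \<L> s0 \<delta>)))"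
  \<comment> \<open>The radius 1 is the one under which the remainder estimate was proved.\<close>
  proof (rule exI[of _ ?K], rule exI[of _ 1], intro conjI allI impI ballI)
    fix n \<phi> \<L> s0 \<delta>
    assume a: "server_model n C M \<phi> \<L>" "s0 \<in> Rn n" "enorm C (gradient C \<L> (\<phi> s0)) = G"
      "\<delta> \<in> Rn n" "enorm n \<delta> \<le> 1" "derivative_bounds_on n C B L \<phi> (segment s0 (vadd s0 \<delta>))"
    from bound[OF a]
    show "(\<L> \<circ> \<phi>) (vadd s0 \<delta>) \<le> F_J n C M \<phi> \<L> s0 \<delta> + ?K * L * (enorm n \<delta>)\<^sup>2" .
    assume "L = 0"
    with bound[OF a] show "(\<L> \<circ> \<phi>) (vadd s0 \<delta>) \<le> F_J n C M \<phi> \<L> s0 \<delta>" by simp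
  qed (use K in auto)
qed (auto simp: F_J_0 server_model_affine simp del: o_apply)

end
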